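(* Let $k,h,d\in\mathbb N$, and fix $V\in M(h,d)$ with rows $v_1,\dots,v_h$, $\beta\in\mathbb R^h$ and $\alpha\in\mathbb R^k$. Let $\kappa:\mathbb R^d\times\mathbb R^d\to\mathbb R$ satisfy $\kappa(w,v)=\kappa(v,w)$ for all $w,v\in\mathbb R^d$, and for $W\in M(k,d)$ with rows $w_1,\dots,w_k$ define $$\mathcal L_\kappa(W,\alpha;V,\beta)=\sum_{i,j=1}^k\alpha_i\alpha_j\kappa(w_i,w_j)-2\sum_{i=1}^k\sum_{j=1}^h\alpha_i\beta_j\kappa(w_i,v_j)+\sum_{i,j=1}^h\beta_i\beta_j\kappa(v_i,v_j).$$ Let $\Gamma_{\beta,V}=\pi_2\big((S_h\times S_d)_V\cap((S_h)_\beta\times S_d)\big)\subseteq S_d$. If $\kappa$ is permutation-invariant, i.e. $\kappa(\sigma w,\sigma v)=\kappa(w,v)$ for all $w,v\in\mathbb R^d$ and $\sigma\in S_d$, then $\mathcal L_\kappa$ is $(S_k)_\alpha\times\Gamma_{\beta,V}$-invariant with respect to $W$, that is, $$\mathcal L_\kappa(\sigma W,\alpha;V,\beta)=\mathcal L_\kappa(W,\alpha;V,\beta)\qquad\text{for all }\sigma\in(S_k)_\alpha\times\Gamma_{\beta,V}\text{ and }W\in M(k,d).$$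
   Context: $M(k,d)$ is the space of real $k\times d$ matrices. $S_m$ acts on $\mathbb R^m$ by $(\sigma w)_i=w_{\sigma^{-1}(i)}$, and $S_k\times S_d$ acts on $M(k,d)$ by $((\sigma_1,\sigma_2)A)_{ij}=A_{\sigma_1^{-1}(i),\sigma_2^{-1}(j)}$ (similarly for $S_h\times S_d$ on $M(h,d)$). A subscript denotes the stabilizer: $(S_m)_x\subseteq S_m$ is the stabilizer of $x\in\mathbb R^m$, and $(S_h\times S_d)_V$ is the stabilizer of $V\in M(h,d)$. $\pi_2$ denotes the projection of a subgroup of $S_h\times S_d$ onto its second component. *)

theory Defs
  imports "HOL-Analysis.Analysis" "HOL-Algebra.Group_Action"
begin

abbreviation Sym :: "('n::finite \<Rightarrow> 'n) monoid"
  where "Sym \<equiv> BijGroup UNIV"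

(* HOL-Algebra reuses the notation inv for group inverses, so the inverse
   function of a permutation is written inv_into UNIV. *)
definition permute_vec :: "('n::finite \<Rightarrow> 'n) \<Rightarrow> real ^ 'n \<Rightarrow> real ^ 'n"
  where "permute_vec \<sigma> w = (\<chi> i. w $ inv_into UNIV \<sigma> i)"

definition permute_mat ::
    "('m::finite \<Rightarrow> 'm) \<times> ('n::finite \<Rightarrow> 'n) \<Rightarrow> real ^ 'n ^ 'm \<Rightarrow> real ^ 'n ^ 'm"
  where "permute_mat \<sigma> A =
    (\<chi> i j. A $ inv_into UNIV (fst \<sigma>) i $ inv_into UNIV (snd \<sigma>) j)"

lemma carrier_BijGroup_UNIV: "carrier (BijGroup UNIV) = {\<sigma>. bij \<sigma>}"
  by (simp add: BijGroup_def Bij_def)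

lemma mult_BijGroup_UNIV:
  "bij \<sigma> \<Longrightarrow> bij \<tau> \<Longrightarrow> \<sigma> \<otimes>\<^bsub>BijGroup UNIV\<^esub> \<tau> = \<sigma> \<circ> \<tau>"
  by (auto simp: BijGroup_def Bij_def compose_def)

lemma permute_vec_comp:
  "bij \<sigma> \<Longrightarrow> bij \<tau> \<Longrightarrow> permute_vec (\<sigma> \<circ> \<tau>) w = permute_vec \<sigma> (permute_vec \<tau> w)"
  by (simp add: permute_vec_def o_inv_distrib vec_eq_iff)

lemma permute_vec_inverse:
  assumes "bij \<sigma>"
  shows "permute_vec (inv_into UNIV \<sigma>) (permute_vec \<sigma> w) = w"
    and "permute_vec \<sigma> (permute_vec (inv_into UNIV \<sigma>) w) = w"
  using assms
  by (simp_all add: permute_vec_def vec_eq_iff inv_inv_eq bij_is_inj bij_is_surj surj_f_inv_f)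

lemma permute_mat_comp:
  "bij \<sigma>1 \<Longrightarrow> bij \<sigma>2 \<Longrightarrow> bij \<tau>1 \<Longrightarrow> bij \<tau>2 \<Longrightarrow>
    permute_mat (\<sigma>1 \<circ> \<tau>1, \<sigma>2 \<circ> \<tau>2) A = permute_mat (\<sigma>1, \<sigma>2) (permute_mat (\<tau>1, \<tau>2) A)"
  by (simp add: permute_mat_def o_inv_distrib vec_eq_iff)

lemma permute_mat_inverse:
  assumes "bij \<sigma>" "bij \<tau>"
  shows "permute_mat (inv_into UNIV \<sigma>, inv_into UNIV \<tau>) (permute_mat (\<sigma>, \<tau>) A) = A"
    and "permute_mat (\<sigma>, \<tau>) (permute_mat (inv_into UNIV \<sigma>, inv_into UNIV \<tau>) A) = A"
  using assms
  by (simp_all add: permute_mat_def vec_eq_iff inv_inv_eq bij_is_inj bij_is_surj surj_f_inv_f)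

lemma bij_permute_vec: "bij \<sigma> \<Longrightarrow> bij (permute_vec \<sigma>)"
  by (rule o_bij[where g = "permute_vec (inv_into UNIV \<sigma>)"])
     (simp_all add: fun_eq_iff permute_vec_inverse)

lemma bij_permute_mat: "bij \<sigma> \<Longrightarrow> bij \<tau> \<Longrightarrow> bij (permute_mat (\<sigma>, \<tau>))"
  by (rule o_bij[where g = "permute_mat (inv_into UNIV \<sigma>, inv_into UNIV \<tau>)"])
     (simp_all add: fun_eq_iff permute_mat_inverse)

lemma group_action_permute_vec: "group_action Sym UNIV permute_vec"
  unfolding group_action_def group_hom_def group_hom_axioms_def hom_def
  by (auto simp: group_BijGroup carrier_BijGroup_UNIV mult_BijGroup_UNIV
      permute_vec_comp bij_permute_vec fun_eq_iff)

lemma group_action_permute_mat: "group_action (Sym \<times>\<times> Sym) UNIV permute_mat"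
  unfolding group_action_def group_hom_def group_hom_axioms_def hom_def
  by (auto simp: DirProd_group group_BijGroup carrier_BijGroup_UNIV mult_BijGroup_UNIV
      permute_mat_comp bij_permute_mat fun_eq_iff)

definition loss ::
    "(real ^ 'd \<Rightarrow> real ^ 'd \<Rightarrow> real) \<Rightarrow> real ^ 'd ^ 'k \<Rightarrow> real ^ 'k \<Rightarrow>
     real ^ 'd ^ 'h \<Rightarrow> real ^ 'h \<Rightarrow> real"
  where "loss \<kappa> W \<alpha> V \<beta> =
      (\<Sum>i\<in>UNIV. \<Sum>j\<in>UNIV. \<alpha> $ i * \<alpha> $ j * \<kappa> (row i W) (row j W))
    - 2 * (\<Sum>i\<in>UNIV. \<Sum>j\<in>UNIV. \<alpha> $ i * \<beta> $ j * \<kappa> (row i W) (row j V))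
    + (\<Sum>i\<in>UNIV. \<Sum>j\<in>UNIV. \<beta> $ i * \<beta> $ j * \<kappa> (row i V) (row j V))"

definition \<Gamma> :: "real ^ 'h \<Rightarrow> real ^ 'd ^ 'h \<Rightarrow> ('d::finite \<Rightarrow> 'd) set"
  where "\<Gamma> \<beta> V =
    snd ` (stabilizer (Sym \<times>\<times> Sym) permute_mat V
           \<inter> (stabilizer Sym permute_vec \<beta> \<times> carrier Sym))"

end

theory Submission
  imports Defs
begin

text \<open>
  The loss does not change when \<open>\<alpha>\<close>, \<open>W\<close> and \<open>\<beta>\<close>, \<open>V\<close> are permuted simultaneously, with
  independent row permutations \<open>\<sigma>\<close> and \<open>\<rho>\<close> and a common column permutation \<open>\<tau>\<close>: \<open>\<tau>\<close> disappears
  by invariance of \<open>\<kappa>\<close>, and \<open>\<sigma>\<close>, \<open>\<rho>\<close> reindex the sums. If \<open>\<sigma>\<close> fixes \<open>\<alpha>\<close> and \<open>\<tau> \<in> \<Gamma> \<beta> V\<close>, there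
  is a \<open>\<rho>\<close> fixing \<open>\<beta>\<close> with \<open>(\<rho>, \<tau>)\<close> fixing \<open>V\<close>, so that only \<open>W\<close> is affected.
\<close>

text \<open>Separates the two factors: \<open>\<tau>\<close> acts inside each row, where invariance
  of \<open>\<kappa>\<close> can remove it, while \<open>\<sigma>\<close> only relabels the
  rows.\<close>

lemma row_permute_mat:
  "row i (permute_mat (\<sigma>, \<tau>) A) = permute_vec \<tau> (row (inv_into UNIV \<sigma> i) A)"
  by (simp add: row_def permute_mat_def permute_vec_def vec_eq_iff)

lemma permute_vec_nth: "permute_vec \<sigma> w $ i = w $ inv_into UNIV \<sigma> i"
  by (simp add: permute_vec_def)

text \<open>Two index types are allowed because the cross term of the loss pairs rows of
  \<open>W\<close> with rows of \<open>V\<close>.\<close>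

lemma sum_reindex_inverse_permutations:
  fixes f :: "'a::finite \<Rightarrow> 'b::finite \<Rightarrow> 'c::comm_monoid_add"
  assumes "bij \<sigma>" "bij \<rho>"
  shows "(\<Sum>i\<in>UNIV. \<Sum>j\<in>UNIV. f (inv_into UNIV \<sigma> i) (inv_into UNIV \<rho> j)) =
    (\<Sum>i\<in>UNIV. \<Sum>j\<in>UNIV. f i j)"
proof -
  have "(\<Sum>j\<in>UNIV. f i (inv_into UNIV \<rho> j)) = (\<Sum>j\<in>UNIV. f i j)" for i
    by (rule sum.reindex_bij_betw[OF bij_imp_bij_inv[OF \<open>bij \<rho>\<close>]])
  then show ?thesis
    using sum.reindex_bij_betw[OF bij_imp_bij_inv[OF \<open>bij \<sigma>\<close>], of "\<lambda>i. \<Sum>j\<in>UNIV. f i j"]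
    by simp
qed

lemma loss_permute:
  fixes W :: "real ^ 'd::finite ^ 'k::finite" and V :: "real ^ 'd ^ 'h::finite"
  assumes "bij \<sigma>" "bij \<rho>"
    and invariant: "\<And>w v. \<kappa> (permute_vec \<tau> w) (permute_vec \<tau> v) = \<kappa> w v"
  shows "loss \<kappa> (permute_mat (\<sigma>, \<tau>) W) (permute_vec \<sigma> \<alpha>)
      (permute_mat (\<rho>, \<tau>) V) (permute_vec \<rho> \<beta>) = loss \<kappa> W \<alpha> V \<beta>"
  unfolding loss_def row_permute_mat permute_vec_nth invariant
  using assms(1,2)
  by (simp add: sum_reindex_inverse_permutations[of \<sigma> \<sigma> "\<lambda>i j. \<alpha> $ i * \<alpha> $ j * \<kappa> (row i W) (row j W)"]
      sum_reindex_inverse_permutations[of \<sigma> \<rho> "\<lambda>i j. \<alpha> $ i * \<beta> $ j * \<kappa> (row i W) (row j V)"]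
      sum_reindex_inverse_permutations[of \<rho> \<rho> "\<lambda>i j. \<beta> $ i * \<beta> $ j * \<kappa> (row i V) (row j V)"])

theorem proposition3:
  fixes V :: "real ^ 'd::finite ^ 'h::finite"
    and \<beta> :: "real ^ 'h"
    and \<alpha> :: "real ^ 'k::finite"
    and \<kappa> :: "real ^ 'd \<Rightarrow> real ^ 'd \<Rightarrow> real"
  assumes symmetric: "\<And>w v. \<kappa> w v = \<kappa> v w"
    and perm_invariant:
      "\<And>\<sigma> w v. \<sigma> \<in> carrier Sym \<Longrightarrow> \<kappa> (permute_vec \<sigma> w) (permute_vec \<sigma> v) = \<kappa> w v"
  shows "\<forall>\<sigma> \<in> stabilizer Sym permute_vec \<alpha> \<times> \<Gamma> \<beta> V. \<forall>W :: real ^ 'd ^ 'k.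
           loss \<kappa> (permute_mat \<sigma> W) \<alpha> V \<beta> = loss \<kappa> W \<alpha> V \<beta>"
proof (intro ballI allI)
  fix \<sigma> and W :: "real ^ 'd ^ 'k"
  assume "\<sigma> \<in> stabilizer Sym permute_vec \<alpha> \<times> \<Gamma> \<beta> V"
  \<comment> \<open>\<open>\<rho>\<close> is the row component that the projection
    \<open>snd\<close> in \<open>\<Gamma>\<close> forgets.\<close>
  then obtain s \<tau> \<rho> where \<sigma>: "\<sigma> = (s, \<tau>)" and bij: "bij s" "bij \<rho>" "bij \<tau>"
    and fixed: "permute_vec s \<alpha> = \<alpha>" "permute_mat (\<rho>, \<tau>) V = V" "permute_vec \<rho> \<beta> = \<beta>"
    unfolding \<Gamma>_def stabilizer_def carrier_BijGroup_UNIV by auto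
  have "\<kappa> (permute_vec \<tau> w) (permute_vec \<tau> v) = \<kappa> w v" for w v
    using perm_invariant \<open>bij \<tau>\<close> by (simp add: carrier_BijGroup_UNIV)
  from loss_permute[where \<kappa> = \<kappa> and \<tau> = \<tau>, OF bij(1,2) this, of W \<alpha> V \<beta>]
  show "loss \<kappa> (permute_mat \<sigma> W) \<alpha> V \<beta> = loss \<kappa> W \<alpha> V \<beta>"
    by (simp add: \<sigma> fixed)
qed

end
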